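(* Let $\mathcal{V}$ be a Euclidean Jordan algebra, let $a,b\in\mathcal{V}$ and $L=a\otimes b$. Then the following statements are equivalent: (i) $a>0,\ b>0$ or $a<0,\ b<0$. (ii) The implication $0\ne x\ge 0\Rightarrow L(x)>0$ holds. (iii) $L\in\mathbf{Q}(\mathcal{V})$.
   Context: A Euclidean Jordan algebra is a (nonzero) finite-dimensional real inner product space $(\mathcal{V},\langle\cdot,\cdot\rangle)$ with a bilinear product $(x,y)\mapsto x\circ y$ satisfying $x\circ y=y\circ x$, $x\circ(x^2\circ y)=x^2\circ(x\circ y)$ where $x^2=x\circ x$, and $\langle x\circ y,z\rangle=\langle x,y\circ z\rangle$; it has a unit element $e$. The inner product is taken to be $\langle x,y\rangle=\mathrm{trace}(x\circ y)$, where the trace of an element is the sum of its eigenvalues (from its spectral decomposition). The symmetric cone is $\mathcal{V}_+=\{x\circ x: x\in\mathcal{V}\}$. Write $x\ge 0$ if $x\in\mathcal{V}_+$, $x>0$ if $x$ is in the interior of $\mathcal{V}_+$, and $x<0$ if $-x>0$. For $a,b\in\mathcal{V}$, $a\otimes b$ is the linear transformation $(a\otimes b)(x):=\langle b,x\rangle\,a$. For a linear $L:\mathcal{V}\to\mathcal{V}$ and $q\in\mathcal{V}$, $\mathrm{LCP}(L,\mathcal{V}_+,q)$ is the problem of finding $x\in\mathcal{V}_+$ with $y:=L(x)+q\in\mathcal{V}_+$ and $\langle x,y\rangle=0$. $L\in\mathbf{Q}(\mathcal{V})$ if $\mathrm{LCP}(L,\mathcal{V}_+,q)$ has a solution for every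 $q\in\mathcal{V}$. *)

theory Defs
  imports "HOL-Analysis.Analysis"
begin

text \<open>
  A Euclidean Jordan algebra is carried by a type of class \<open>euclidean_space\<close> (a nonzero
  finite-dimensional real inner product space); the Jordan product \<open>jp\<close> and the unit \<open>e\<close> are
  parameters. The inner product of the type is the trace inner product of the algebra.
\<close>

definition jordan_idempotent :: "('a::euclidean_space \<Rightarrow> 'a \<Rightarrow> 'a) \<Rightarrow> 'a \<Rightarrow> bool" where
  "jordan_idempotent jp c \<longleftrightarrow> jp c c = c"

definition jordan_primitive :: "('a::euclidean_space \<Rightarrow> 'a \<Rightarrow> 'a) \<Rightarrow> 'a \<Rightarrow> bool" where
  "jordan_primitive jp c \<longleftrightarrow> jordan_idempotent jp c \<and> c \<noteq> 0 \<and>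
     \<not> (\<exists>c1 c2. jordan_idempotent jp c1 \<and> c1 \<noteq> 0 \<and> jordan_idempotent jp c2 \<and> c2 \<noteq> 0 \<and> c = c1 + c2)"

definition jordan_frame :: "('a::euclidean_space \<Rightarrow> 'a \<Rightarrow> 'a) \<Rightarrow> 'a \<Rightarrow> 'a set \<Rightarrow> bool" where
  "jordan_frame jp e F \<longleftrightarrow> finite F \<and> (\<forall>c\<in>F. jordan_primitive jp c) \<and>
     (\<forall>c\<in>F. \<forall>d\<in>F. c \<noteq> d \<longrightarrow> jp c d = 0) \<and> \<Sum>F = e"

text \<open>
  By the spectral theorem every \<open>x\<close> has a decomposition \<open>x = (\<Sum>c\<in>F. l c *\<^sub>R c)\<close> over some Jordan
  frame \<open>F\<close>, and the eigenvalues \<open>l c\<close>, counted with multiplicity, depend on \<open>x\<close> only, so the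
  description below denotes their sum.
\<close>
definition jordan_trace :: "('a::euclidean_space \<Rightarrow> 'a \<Rightarrow> 'a) \<Rightarrow> 'a \<Rightarrow> 'a \<Rightarrow> real" where
  "jordan_trace jp e x =
     (THE t. \<exists>F l. jordan_frame jp e F \<and> x = (\<Sum>c\<in>F. l c *\<^sub>R c) \<and> t = (\<Sum>c\<in>F. l c))"

locale euclidean_jordan_algebra =
  fixes jp :: "'a::euclidean_space \<Rightarrow> 'a \<Rightarrow> 'a"
    and e :: 'a
  assumes jp_bilinear: "bilinear jp"
    and jp_commute: "jp x y = jp y x"
    and jordan_identity: "jp x (jp (jp x x) y) = jp (jp x x) (jp x y)"
    and inner_jp_assoc: "jp x y \<bullet> z = x \<bullet> jp y z"
    and jp_unit: "jp e x = x"
    and inner_eq_trace: "x \<bullet> y = jordan_trace jp e (jp x y)"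

definition symmetric_cone :: "('a::euclidean_space \<Rightarrow> 'a \<Rightarrow> 'a) \<Rightarrow> 'a set" where
  "symmetric_cone jp = {jp x x | x. True}"

definition cone_nonneg :: "('a::euclidean_space \<Rightarrow> 'a \<Rightarrow> 'a) \<Rightarrow> 'a \<Rightarrow> bool" where
  "cone_nonneg jp x \<longleftrightarrow> x \<in> symmetric_cone jp"

definition cone_pos :: "('a::euclidean_space \<Rightarrow> 'a \<Rightarrow> 'a) \<Rightarrow> 'a \<Rightarrow> bool" where
  "cone_pos jp x \<longleftrightarrow> x \<in> interior (symmetric_cone jp)"

definition cone_neg :: "('a::euclidean_space \<Rightarrow> 'a \<Rightarrow> 'a) \<Rightarrow> 'a \<Rightarrow> bool" where
  "cone_neg jp x \<longleftrightarrow> cone_pos jp (- x)"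

definition rank_one :: "'a::euclidean_space \<Rightarrow> 'a \<Rightarrow> 'a \<Rightarrow> 'a" where
  "rank_one a b x = (b \<bullet> x) *\<^sub>R a"

definition LCP_solution :: "('a::euclidean_space \<Rightarrow> 'a) \<Rightarrow> 'a set \<Rightarrow> 'a \<Rightarrow> 'a \<Rightarrow> bool" where
  "LCP_solution L K q x \<longleftrightarrow> x \<in> K \<and> L x + q \<in> K \<and> x \<bullet> (L x + q) = 0"

definition Q_transformations :: "('a::euclidean_space \<Rightarrow> 'a \<Rightarrow> 'a) \<Rightarrow> ('a \<Rightarrow> 'a) set" where
  "Q_transformations jp = {L. linear L \<and> (\<forall>q. \<exists>x. LCP_solution L (symmetric_cone jp) q x)}"

end

(* The cone of squares is self-dual, and the equivalence holds over every self-dual cone K. If a and b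
   are interior, q is not in K, and t > 0 is least with t a + q in K, then some nonzero y in K is
   orthogonal to t a + q, and a multiple of y solves the LCP. Conversely, solvability for -q interior
   forces a or -a into the interior. If a is interior, let beta be the minimum of <b,x>/<a,x> over K, so
   that w = b - beta a lies on the boundary of K; for beta <= 0 the problem with q = w - a has no
   solution, hence beta > 0 and b is interior.

   Self-duality rests on the spectral decomposition of x: the component c of the unit in an eigenspace of
   L_x within the span of the powers of x is an idempotent, because L_c commutes with L_x. *)

theory Submission
  imports Defs
begin

section \<open>Linear complementarity for rank-one maps over self-dual cones\<close>

locale self_dual_cone =
  fixes K :: "'a::euclidean_space set"
  assumes self_dual: "y \<in> K \<longleftrightarrow> (\<forall>x\<in>K. 0 \<le> x \<bullet> y)"
begin

section \<open>Closure properties, compact base and interior of a self-dual cone\<close>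

lemma inner_nonneg: "x \<in> K \<Longrightarrow> y \<in> K \<Longrightarrow> 0 \<le> x \<bullet> y"
  using self_dual by blast

lemma zero_mem: "0 \<in> K"
  by (simp add: self_dual[of 0])

lemma add_mem: "x \<in> K \<Longrightarrow> y \<in> K \<Longrightarrow> x + y \<in> K"
  by (subst self_dual) (auto simp: inner_add_right inner_nonneg)

lemma scale_mem: "x \<in> K \<Longrightarrow> 0 \<le> t \<Longrightarrow> t *\<^sub>R x \<in> K"
  by (subst self_dual) (auto simp: inner_nonneg)

lemma closed_cone: "closed K"
proof -
  have "K = (\<Inter>x\<in>K. {y. 0 \<le> x \<bullet> y})"
    by (rule set_eqI) (simp, rule self_dual)
  moreover have "closed (\<Inter>x\<in>K. {y. 0 \<le> x \<bullet> y})"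
    by (intro closed_INT ballI closed_Collect_le continuous_intros)
  ultimately show ?thesis
    by simp
qed

lemma compact_base: "compact (K \<inter> sphere 0 1)"
  by (simp add: closed_Int_compact closed_cone)

text \<open>The dual of \<open>{0}\<close> is the whole space, which is nonzero because
  \<open>Basis\<close> is nonempty.\<close>

lemma nonzero_mem: obtains x where "x \<in> K" "x \<noteq> 0"
proof -
  have "K \<noteq> {0}"
  proof
    assume "K = {0}"
    then have "y = 0" for y :: 'a
      using self_dual[of y] by simp
    then show False
      using nonempty_Basis nonzero_Basis by blast
  qed
  then show ?thesis
    using that zero_mem by blast
qed

lemma base_nonempty: "K \<inter> sphere 0 1 \<noteq> {}"
proof -
  obtain x where x: "x \<in> K" "x \<noteq> 0"
    by (rule nonzero_mem)
  then have "(1 / norm x) *\<^sub>R x \<in> K \<inter> sphere 0 1"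
    using scale_mem[of x "1 / norm x"] by simp
  then show ?thesis
    by blast
qed

text \<open>If \<open>y\<close> is interior, subtracting a small multiple of \<open>x\<close> stays
  in \<open>K\<close>, and pairing with \<open>x\<close> gives strict positivity. Conversely,
  compactness bounds \<open>x \<bullet> y\<close> below by some m > 0 on unit vectors of
  \<open>K\<close>; by Cauchy-Schwarz the ball of radius m about \<open>y\<close> lies in the dual
  cone, which is \<open>K\<close>.\<close>

lemma mem_interior_iff: "y \<in> interior K \<longleftrightarrow> (\<forall>x\<in>K. x \<noteq> 0 \<longrightarrow> 0 < x \<bullet> y)"
proof
  assume "y \<in> interior K"
  then obtain d where d: "0 < d" "cball y d \<subseteq> K"
    using mem_interior_cball by blast
  show "\<forall>x\<in>K. x \<noteq> 0 \<longrightarrow> 0 < x \<bullet> y"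
  proof (intro ballI impI)
    fix x assume x: "x \<in> K" "x \<noteq> 0"
    have "y - (d / norm x) *\<^sub>R x \<in> cball y d"
      using x d by (simp add: dist_norm)
    then have "0 \<le> x \<bullet> (y - (d / norm x) *\<^sub>R x)"
      using d x inner_nonneg by blast
    moreover have "0 < x \<bullet> ((d / norm x) *\<^sub>R x)"
      using x d by simp
    ultimately show "0 < x \<bullet> y"
      by (simp add: inner_diff_right)
  qed
next
  assume pos: "\<forall>x\<in>K. x \<noteq> 0 \<longrightarrow> 0 < x \<bullet> y"
  have "continuous_on (K \<inter> sphere 0 1) (\<lambda>x. x \<bullet> y)"
    by (intro continuous_intros)
  then obtain z where z: "z \<in> K \<inter> sphere 0 1" "\<And>x. x \<in> K \<inter> sphere 0 1 \<Longrightarrow> z \<bullet> y \<le> x \<bullet> y"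
    using continuous_attains_inf[OF compact_base base_nonempty] by blast
  have zpos: "0 < z \<bullet> y"
    using z(1) pos by auto
  have "ball y (z \<bullet> y) \<subseteq> K"
  proof
    fix u assume "u \<in> ball y (z \<bullet> y)"
    then have u: "norm (u - y) < z \<bullet> y"
      by (simp add: dist_norm norm_minus_commute)
    have "0 \<le> x \<bullet> u" if x: "x \<in> K" for x
    proof (cases "x = 0")
      case False
      have "(1 / norm x) *\<^sub>R x \<in> K \<inter> sphere 0 1"
        using False x scale_mem[of x "1 / norm x"] by simp
      from z(2)[OF this] have "norm x * (z \<bullet> y) \<le> x \<bullet> y"
        using False by (simp add: field_simps)
      moreover have "\<bar>x \<bullet> (u - y)\<bar> \<le> norm x * norm (u - y)"
        by (rule Cauchy_Schwarz_ineq2)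
      moreover have "norm x * norm (u - y) \<le> norm x * (z \<bullet> y)"
        using u by (intro mult_left_mono) auto
      moreover have "x \<bullet> u = x \<bullet> y + x \<bullet> (u - y)"
        by (simp add: inner_diff_right)
      ultimately show ?thesis
        by linarith
    qed simp
    then show "u \<in> K"
      by (subst self_dual) auto
  qed
  then show "y \<in> interior K"
    using zpos mem_interior by blast
qed

lemma interior_pos: "y \<in> interior K \<Longrightarrow> x \<in> K \<Longrightarrow> x \<noteq> 0 \<Longrightarrow> 0 < x \<bullet> y"
  using mem_interior_iff by blast

lemma interior_add: "x \<in> interior K \<Longrightarrow> y \<in> K \<Longrightarrow> x + y \<in> interior K"
  unfolding mem_interior_iff by (auto simp: inner_add_right intro!: add_pos_nonneg inner_nonneg)

lemma interior_scale: "x \<in> interior K \<Longrightarrow> 0 < t \<Longrightarrow> t *\<^sub>R x \<in> interior K"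
  unfolding mem_interior_iff by auto

lemma interior_scale_cancel: "t *\<^sub>R x \<in> interior K \<Longrightarrow> 0 < t \<Longrightarrow> x \<in> interior K"
  using interior_scale[of "t *\<^sub>R x" "1 / t"] by simp

text \<open>The sum of a basis of the span of \<open>K\<close> chosen inside \<open>K\<close> is
  interior: an \<open>x\<close> in \<open>K\<close> pairing to zero with it is orthogonal to every
  basis vector, hence to itself.\<close>

lemma interior_nonempty: "interior K \<noteq> {}"
proof -
  obtain B where B: "B \<subseteq> K" "independent B" "K \<subseteq> span B" "card B = dim K"
    by (rule basis_exists)
  have "0 < x \<bullet> \<Sum>B" if x: "x \<in> K" "x \<noteq> 0" for x
  proof -
    have nonneg: "0 \<le> x \<bullet> b" if "b \<in> B" for b
      using that x(1) B(1) by (intro inner_nonneg) auto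
    have "x \<bullet> \<Sum>B \<noteq> 0"
    proof
      assume "x \<bullet> \<Sum>B = 0"
      then have "(\<Sum>b\<in>B. x \<bullet> b) = 0"
        by (simp add: inner_sum_right)
      then have "\<forall>b\<in>B. x \<bullet> b = 0"
        using sum_nonneg_eq_0_iff[of B "(\<bullet>) x"] independent_imp_finite[OF B(2)] nonneg by simp
      moreover have "x \<in> span B"
        using B(3) x(1) by (rule subsetD)
      ultimately have "orthogonal x x"
        using orthogonal_to_span[of x B x] by (simp add: orthogonal_def)
      then show False
        using x(2) by (simp add: orthogonal_self)
    qed
    moreover have "0 \<le> x \<bullet> \<Sum>B"
      using nonneg by (simp add: inner_sum_right sum_nonneg)
    ultimately show ?thesis
      by simp
  qed
  then have "\<Sum>B \<in> interior K"
    unfolding mem_interior_iff by blast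
  then show ?thesis
    by blast
qed

lemma interior_scale_pos:
  assumes "a \<in> interior K" "t *\<^sub>R a \<in> interior K"
  shows "0 < t"
proof -
  obtain x where x: "x \<in> K" "x \<noteq> 0"
    by (rule nonzero_mem)
  have "0 < x \<bullet> a" "0 < t * (x \<bullet> a)"
    using interior_pos[OF assms(1) x] interior_pos[OF assms(2) x] by simp_all
  then show ?thesis
    by (simp add: zero_less_mult_iff)
qed

section \<open>Rank-one complementarity problems over the cone\<close>

text \<open>\<open>\<beta>\<close> is the minimum of \<open>(x \<bullet> c) / (x \<bullet> a)\<close> over the cone, attained at \<open>y\<close>.\<close>

lemma boundary_translate:
  assumes a: "a \<in> interior K"
  obtains \<beta> y where "y \<in> K" "y \<noteq> 0" "c - \<beta> *\<^sub>R a \<in> K" "y \<bullet> (c - \<beta> *\<^sub>R a) = 0"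
proof -
  have nz: "0 < x \<bullet> a" if "x \<in> K \<inter> sphere 0 1" for x
    using that by (intro interior_pos[OF a]) auto
  have "continuous_on (K \<inter> sphere 0 1) (\<lambda>x. (x \<bullet> c) / (x \<bullet> a))"
    using nz by (intro continuous_intros) force
  then obtain y where y: "y \<in> K \<inter> sphere 0 1"
    "\<And>x. x \<in> K \<inter> sphere 0 1 \<Longrightarrow> (y \<bullet> c) / (y \<bullet> a) \<le> (x \<bullet> c) / (x \<bullet> a)"
    using continuous_attains_inf[OF compact_base base_nonempty] by blast
  define \<beta> where "\<beta> = (y \<bullet> c) / (y \<bullet> a)"
  have "0 \<le> x \<bullet> (c - \<beta> *\<^sub>R a)" if x: "x \<in> K" for x
  proof (cases "x = 0")
    case False
    have "(1 / norm x) *\<^sub>R x \<in> K \<inter> sphere 0 1"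
      using False x scale_mem[of x "1 / norm x"] by simp
    from y(2)[OF this] have "\<beta> \<le> (x \<bullet> c) / (x \<bullet> a)"
      using False by (simp add: \<beta>_def)
    then show ?thesis
      using interior_pos[OF a x False] by (simp add: inner_diff_right pos_le_divide_eq)
  qed simp
  then have "c - \<beta> *\<^sub>R a \<in> K"
    by (subst self_dual) auto
  moreover have "y \<bullet> (c - \<beta> *\<^sub>R a) = 0"
    using nz[OF y(1)] by (simp add: \<beta>_def inner_diff_right)
  moreover have "y \<in> K" "y \<noteq> 0"
    using y(1) by auto
  ultimately show ?thesis
    using that by blast
qed

lemma rank_one_LCP_solvable:
  assumes a: "a \<in> interior K" and b: "b \<in> interior K"
  shows "\<exists>x. LCP_solution (rank_one a b) K q x"
proof (cases "q \<in> K")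
  case True
  then have "LCP_solution (rank_one a b) K q 0"
    by (simp add: LCP_solution_def rank_one_def zero_mem)
  then show ?thesis ..
next
  case False
  obtain \<beta> y where y: "y \<in> K" "y \<noteq> 0" "q - \<beta> *\<^sub>R a \<in> K" "y \<bullet> (q - \<beta> *\<^sub>R a) = 0"
    using boundary_translate[OF a] by blast
  \<comment> \<open>Otherwise \<open>q\<close> would be the sum of two elements of
    \<open>K\<close>.\<close>
  have "\<beta> < 0"
  proof (rule ccontr)
    assume "\<not> \<beta> < 0"
    then have "(q - \<beta> *\<^sub>R a) + \<beta> *\<^sub>R a \<in> K"
      using a interior_subset by (intro add_mem y scale_mem) auto
    then show False
      using False by simp
  qed
  have by_pos: "0 < y \<bullet> b"
    using interior_pos[OF b] y by blast
  \<comment> \<open>The factor is chosen so that \<open>b \<bullet> x = - \<beta>\<close>, which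
    moves \<open>q\<close> to the boundary point orthogonal to \<open>y\<close>.\<close>
  define x where "x = (- \<beta> / (y \<bullet> b)) *\<^sub>R y"
  have "rank_one a b x + q = q - \<beta> *\<^sub>R a"
    using by_pos by (simp add: rank_one_def x_def inner_commute)
  moreover have "x \<in> K"
    unfolding x_def using \<open>\<beta> < 0\<close> by_pos y(1) by (intro scale_mem divide_nonneg_pos) auto
  ultimately have "LCP_solution (rank_one a b) K q x"
    using y by (simp add: LCP_solution_def x_def)
  then show ?thesis ..
qed

lemma LCP_solvable_imp_right_interior:
  assumes a: "a \<in> interior K" and Q: "\<And>q. \<exists>x. LCP_solution (rank_one a b) K q x"
  shows "b \<in> interior K"
proof -
  obtain \<beta> y where y: "y \<in> K" "y \<noteq> 0" "b - \<beta> *\<^sub>R a \<in> K" "y \<bullet> (b - \<beta> *\<^sub>R a) = 0"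
    using boundary_translate[OF a] by blast
  define w where "w = b - \<beta> *\<^sub>R a"
  \<comment> \<open>Subtracting \<open>a\<close> from the boundary point \<open>w\<close> leaves
    \<open>K\<close>, so that the solution must compensate with \<open>b \<bullet> x\<close> at
    least 1.\<close>
  obtain x where x: "x \<in> K" "(b \<bullet> x) *\<^sub>R a + (w - a) \<in> K" "x \<bullet> ((b \<bullet> x) *\<^sub>R a + (w - a)) = 0"
    using Q[of "w - a"] unfolding LCP_solution_def rank_one_def by blast
  define t where "t = b \<bullet> x"
  have eq: "(b \<bullet> x) *\<^sub>R a + (w - a) = w + (t - 1) *\<^sub>R a"
    by (simp add: t_def algebra_simps)
  \<comment> \<open>Pairing with \<open>y\<close> kills \<open>w\<close> and isolates the sign of
    \<open>t - 1\<close>.\<close>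
  have "0 \<le> y \<bullet> (w + (t - 1) *\<^sub>R a)"
    using inner_nonneg[OF y(1) x(2)] eq by simp
  then have "0 \<le> (t - 1) * (y \<bullet> a)"
    using y(4) by (simp add: w_def inner_add_right)
  then have t: "1 \<le> t"
    using interior_pos[OF a y(1,2)] by (simp add: zero_le_mult_iff)
  have xa: "0 \<le> x \<bullet> a"
    using inner_nonneg x(1) a interior_subset by blast
  \<comment> \<open>Complementarity makes a sum of two nonnegative terms vanish, so \<open>x\<close>
    is orthogonal to \<open>w\<close>.\<close>
  have "x \<bullet> w + (t - 1) * (x \<bullet> a) = 0"
    using x(3) eq by (simp add: inner_add_right)
  moreover have "0 \<le> x \<bullet> w"
    using inner_nonneg x(1) y(3) w_def by blast
  moreover have "0 \<le> (t - 1) * (x \<bullet> a)"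
    using t xa by simp
  ultimately have "x \<bullet> w = 0"
    by linarith
  then have "t = \<beta> * (x \<bullet> a)"
    by (simp add: t_def w_def inner_diff_right inner_commute)
  then have "0 < \<beta>"
    using t xa by (metis linorder_not_less mult_nonpos_nonneg not_one_le_zero order_trans)
  then have "\<beta> *\<^sub>R a + (b - \<beta> *\<^sub>R a) \<in> interior K"
    using a y(3) by (intro interior_add interior_scale)
  then show ?thesis
    by simp
qed

text \<open>Reduces the case of negative \<open>a\<close> and \<open>b\<close> to the positive
  one.\<close>

lemma rank_one_uminus: "rank_one (- a) (- b) = rank_one a b"
  by (simp add: rank_one_def fun_eq_iff)

text \<open>Every value of the map is a multiple of \<open>a\<close>. A single interior value
  therefore puts \<open>a\<close> or \<open>- a\<close> in the interior; after a change of both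
  signs, positivity of \<open>b \<bullet> x\<close> on nonzero \<open>x\<close> in \<open>K\<close>
  is the interior criterion for \<open>b\<close>.\<close>

lemma rank_one_positive_iff:
  "(a \<in> interior K \<and> b \<in> interior K \<or> - a \<in> interior K \<and> - b \<in> interior K) \<longleftrightarrow>
     (\<forall>x. x \<noteq> 0 \<and> x \<in> K \<longrightarrow> rank_one a b x \<in> interior K)"
proof
  have *: "rank_one a b x \<in> interior K"
    if "a \<in> interior K" "b \<in> interior K" "x \<noteq> 0" "x \<in> K" for a b x
    unfolding rank_one_def using that interior_pos[of b x]
    by (intro interior_scale) (auto simp: inner_commute)
  assume "a \<in> interior K \<and> b \<in> interior K \<or> - a \<in> interior K \<and> - b \<in> interior K"
  then show "\<forall>x. x \<noteq> 0 \<and> x \<in> K \<longrightarrow> rank_one a b x \<in> interior K"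
    using *[of a b] *[of "- a" "- b"] by (auto simp: rank_one_uminus)
next
  have *: "b \<in> interior K"
    if "a \<in> interior K" "\<forall>x. x \<noteq> 0 \<and> x \<in> K \<longrightarrow> rank_one a b x \<in> interior K" for a b
    unfolding mem_interior_iff using that interior_scale_pos[of a]
    by (auto simp: rank_one_def inner_commute)
  assume pos: "\<forall>x. x \<noteq> 0 \<and> x \<in> K \<longrightarrow> rank_one a b x \<in> interior K"
  obtain x where "x \<in> K" "x \<noteq> 0"
    by (rule nonzero_mem)
  with pos have int: "(b \<bullet> x) *\<^sub>R a \<in> interior K"
    by (auto simp: rank_one_def)
  have "0 \<notin> interior K"
    using interior_pos \<open>x \<in> K\<close> \<open>x \<noteq> 0\<close> by fastforce
  then have "b \<bullet> x \<noteq> 0"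
    using int by auto
  then have "a \<in> interior K \<or> - a \<in> interior K"
    using int interior_scale_cancel[of "b \<bullet> x" a] interior_scale_cancel[of "- (b \<bullet> x)" "- a"]
    by (cases "0 < b \<bullet> x") auto
  then show "a \<in> interior K \<and> b \<in> interior K \<or> - a \<in> interior K \<and> - b \<in> interior K"
    using pos *[of a b] *[of "- a" "- b"] by (auto simp: rank_one_uminus)
qed

lemma rank_one_LCP_solvable_iff:
  "(\<forall>q. \<exists>x. LCP_solution (rank_one a b) K q x) \<longleftrightarrow>
     a \<in> interior K \<and> b \<in> interior K \<or> - a \<in> interior K \<and> - b \<in> interior K"
proof
  assume Q: "\<forall>q. \<exists>x. LCP_solution (rank_one a b) K q x"
  obtain p where p: "p \<in> interior K"
    using interior_nonempty by blast
  \<comment> \<open>For \<open>q = - p\<close> the solution dominates the interior point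
    \<open>p\<close>, which forces the multiple of \<open>a\<close> into the interior.\<close>
  obtain x where x: "(b \<bullet> x) *\<^sub>R a - p \<in> K"
    using Q[rule_format, of "- p"] unfolding LCP_solution_def rank_one_def by auto
  have int: "(b \<bullet> x) *\<^sub>R a \<in> interior K"
    using interior_add[OF p x] by simp
  obtain y where "y \<in> K" "y \<noteq> 0"
    by (rule nonzero_mem)
  then have "0 \<notin> interior K"
    using interior_pos by fastforce
  then have "b \<bullet> x \<noteq> 0"
    using int by auto
  then have "a \<in> interior K \<or> - a \<in> interior K"
    using int interior_scale_cancel[of "b \<bullet> x" a] interior_scale_cancel[of "- (b \<bullet> x)" "- a"]
    by (cases "0 < b \<bullet> x") auto
  then show "a \<in> interior K \<and> b \<in> interior K \<or> - a \<in> interior K \<and> - b \<in> interior K"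
    using Q LCP_solvable_imp_right_interior[of a b] LCP_solvable_imp_right_interior[of "- a" "- b"]
    by (auto simp: rank_one_uminus)
next
  assume "a \<in> interior K \<and> b \<in> interior K \<or> - a \<in> interior K \<and> - b \<in> interior K"
  then show "\<forall>q. \<exists>x. LCP_solution (rank_one a b) K q x"
    using rank_one_LCP_solvable[of a b] rank_one_LCP_solvable[of "- a" "- b"]
    by (auto simp: rank_one_uminus)
qed

end

section \<open>Eigenvectors of self-adjoint maps\<close>

text \<open>A maximizer \<open>w\<close> of the quadratic form on the unit sphere of
  \<open>A\<close> is an eigenvector: the residual \<open>r\<close> is a direction of first-order
  increase unless it vanishes.\<close>

lemma self_adjoint_eigenvector:
  fixes T :: "'a::euclidean_space \<Rightarrow> 'a"
  assumes lin: "linear T" and adj: "\<And>u v. T u \<bullet> v = u \<bullet> T v"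
    and A: "subspace A" and inv: "\<And>v. v \<in> A \<Longrightarrow> T v \<in> A" and nz: "A \<noteq> {0}"
  obtains w \<mu> where "w \<in> A" "norm w = 1" "T w = \<mu> *\<^sub>R w"
proof -
  have comp: "compact (A \<inter> sphere 0 1)"
    by (simp add: closed_Int_compact closed_subspace[OF A])
  obtain v0 where v0: "v0 \<in> A" "v0 \<noteq> 0"
    using nz A subspace_0 by blast
  then have "(1 / norm v0) *\<^sub>R v0 \<in> A \<inter> sphere 0 1"
    using A by (simp add: subspace_scale)
  then have ne: "A \<inter> sphere 0 1 \<noteq> {}"
    by blast
  have "continuous_on (A \<inter> sphere 0 1) (\<lambda>v. T v \<bullet> v)"
    using lin by (intro continuous_intros linear_continuous_on) (simp add: linear_conv_bounded_linear)
  then obtain w where w: "w \<in> A \<inter> sphere 0 1" "\<And>v. v \<in> A \<inter> sphere 0 1 \<Longrightarrow> T v \<bullet> v \<le> T w \<bullet> w"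
    using continuous_attains_sup[OF comp ne] by blast
  define \<mu> where "\<mu> = T w \<bullet> w"
  have form: "T v \<bullet> v \<le> \<mu> * (v \<bullet> v)" if v: "v \<in> A" for v
  proof (cases "v = 0")
    case False
    have "(1 / norm v) *\<^sub>R v \<in> A \<inter> sphere 0 1"
      using False v A by (simp add: subspace_scale)
    from w(2)[OF this] have "(1 / norm v) * (1 / norm v) * (T v \<bullet> v) \<le> \<mu>"
      by (simp add: \<mu>_def linear_scale[OF lin])
    then show ?thesis
      using False by (simp add: dot_square_norm power2_eq_square field_simps)
  qed (simp add: linear_0[OF lin])
  have ww: "w \<bullet> w = 1" and wA: "w \<in> A"
    using w(1) by (auto simp: norm_eq_1)
  define r where "r = T w - \<mu> *\<^sub>R w"
  define B where "B = \<mu> * (r \<bullet> r) - T r \<bullet> r"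
  have rA: "r \<in> A"
    unfolding r_def using wA A inv by (intro subspace_diff subspace_scale) auto
  have B: "0 \<le> B"
    using form[OF rA] by (simp add: B_def)
  \<comment> \<open>Compare the form at \<open>w + s *\<^sub>R r\<close> with its bound: the
    constant terms cancel, the linear term is \<open>2 * s * (r \<bullet> r)\<close>, and
    \<open>B\<close> collects the quadratic ones.\<close>
  have small: "2 * (r \<bullet> r) \<le> s * B" if s: "0 < s" for s
  proof -
    have "w + s *\<^sub>R r \<in> A"
      using wA rA A by (intro subspace_add subspace_scale)
    from form[OF this] have "2 * s * (T w \<bullet> r) + s * s * (T r \<bullet> r)
        \<le> \<mu> * (2 * s * (w \<bullet> r)) + \<mu> * (s * s * (r \<bullet> r))"
      using adj[of r w] ww
      by (simp add: linear_add[OF lin] linear_scale[OF lin] inner_add_left inner_add_right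
          inner_commute \<mu>_def algebra_simps)
    moreover have "T w \<bullet> r = \<mu> * (w \<bullet> r) + r \<bullet> r"
      by (simp add: r_def inner_diff_left inner_diff_right algebra_simps)
    ultimately have "s * (2 * (r \<bullet> r)) \<le> s * (s * B)"
      by (simp add: B_def algebra_simps)
    then show ?thesis
      using s by simp
  qed
  have "r \<bullet> r \<le> 0"
  proof (rule ccontr)
    assume "\<not> r \<bullet> r \<le> 0"
    then have pos: "0 < r \<bullet> r"
      by (simp only: not_le)
    \<comment> \<open>This \<open>s\<close> makes \<open>s * B\<close> at most
      \<open>r \<bullet> r\<close>; the added 1 keeps the denominator positive when
      \<open>B = 0\<close>.\<close>
    then have "2 * (r \<bullet> r) \<le> (r \<bullet> r) * (B / (B + 1))"
      using small[of "(r \<bullet> r) / (B + 1)"] B by simp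
    also have "\<dots> \<le> (r \<bullet> r) * 1"
      using B by (intro mult_left_mono) auto
    finally show False
      using pos by linarith
  qed
  then have "r = 0"
    using inner_gt_zero_iff[of r] by linarith
  then show ?thesis
    using that[of w \<mu>] w(1) by (simp add: r_def)
qed

text \<open>Induction on the dimension: split off a unit eigenvector \<open>w\<close> and pass to
  its orthogonal complement in \<open>A\<close>, which \<open>T\<close> preserves. Indexing the
  components by the eigenvalue itself merges those with equal eigenvalue.\<close>

lemma self_adjoint_eigen_decomposition:
  fixes T :: "'a::euclidean_space \<Rightarrow> 'a"
  assumes lin: "linear T" and adj: "\<And>u v. T u \<bullet> v = u \<bullet> T v"
    and "subspace A" and "\<And>v. v \<in> A \<Longrightarrow> T v \<in> A" and "v \<in> A"
  shows "\<exists>S c. finite S \<and> (\<forall>\<mu>. c \<mu> \<in> A \<and> T (c \<mu>) = \<mu> *\<^sub>R c \<mu>) \<and> v = (\<Sum>\<mu>\<in>S. c \<mu>)"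
  using assms(3-5)
proof (induction "dim A" arbitrary: A v rule: less_induct)
  case less
  note A = less.prems(1) and inv = less.prems(2) and v = less.prems(3)
  show ?case
  proof (cases "A = {0}")
    case True
    then have "v = (\<Sum>\<mu>\<in>{}. (\<lambda>_. 0) \<mu>)"
      using v by simp
    then show ?thesis
      using linear_0[OF lin] A
      by (intro exI[of _ "{}"] exI[of _ "\<lambda>_. 0"]) (auto simp: subspace_0)
  next
    case False
    obtain w \<mu> where w: "w \<in> A" "norm w = 1" "T w = \<mu> *\<^sub>R w"
      using self_adjoint_eigenvector[OF lin adj A inv False] by blast
    have ww: "w \<bullet> w = 1"
      using w(2) by (simp add: norm_eq_1)
    define A' where "A' = A \<inter> {u. w \<bullet> u = 0}"
    have A': "subspace A'"
      unfolding A'_def using A by (simp add: subspace_inter subspace_hyperplane)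
    have inv': "T u \<in> A'" if "u \<in> A'" for u
      using that inv adj[of w u] w(3) by (auto simp: A'_def)
    have "w \<notin> A'"
      using ww by (simp add: A'_def)
    then have "A' \<subset> A"
      using w(1) A'_def by blast
    then have "span A' \<subset> span A"
      using A A' by (simp only: span_eq_iff[THEN iffD2])
    then have lt: "dim A' < dim A"
      by (rule dim_psubset)
    define \<alpha> where "\<alpha> = w \<bullet> v"
    have "v - \<alpha> *\<^sub>R w \<in> A'"
      using v w(1) A ww by (auto simp: A'_def \<alpha>_def inner_diff_right subspace_diff subspace_scale)
    note less.hyps[OF lt A' inv' this]
    then obtain S c where S: "finite S" and c: "\<And>\<nu>. c \<nu> \<in> A'" "\<And>\<nu>. T (c \<nu>) = \<nu> *\<^sub>R c \<nu>"
      and sum: "v - \<alpha> *\<^sub>R w = (\<Sum>\<nu>\<in>S. c \<nu>)"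
      by auto
    \<comment> \<open>The eigenvalue \<open>\<mu>\<close> may already occur in \<open>S\<close>, in
      which case the components add up. Outside \<open>S\<close> the function \<open>c\<close> may
      be nonzero, so it is cut off.\<close>
    define d where "d \<nu> = (if \<nu> \<in> S then c \<nu> else 0) + (if \<nu> = \<mu> then \<alpha> *\<^sub>R w else 0)" for \<nu>
    have "d \<nu> \<in> A" for \<nu>
      unfolding d_def using c(1)[of \<nu>] w(1) A'_def
      by (intro subspace_add[OF A]) (auto simp: subspace_scale[OF A] subspace_0[OF A])
    moreover have "T (d \<nu>) = \<nu> *\<^sub>R d \<nu>" for \<nu>
      by (simp add: d_def c(2) w(3) linear_add[OF lin] linear_scale[OF lin] linear_0[OF lin]
          scaleR_add_right)
    moreover have "v = (\<Sum>\<nu>\<in>insert \<mu> S. d \<nu>)"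
    proof -
      have "(\<Sum>\<nu>\<in>insert \<mu> S. d \<nu>) =
          (\<Sum>\<nu>\<in>insert \<mu> S. if \<nu> \<in> S then c \<nu> else 0) + (\<Sum>\<nu>\<in>insert \<mu> S. if \<nu> = \<mu> then \<alpha> *\<^sub>R w else 0)"
        by (simp only: d_def sum.distrib)
      also have "(\<Sum>\<nu>\<in>insert \<mu> S. if \<nu> \<in> S then c \<nu> else 0) = (\<Sum>\<nu>\<in>S. c \<nu>)"
        using S by (intro sum.mono_neutral_cong_right) auto
      also have "(\<Sum>\<nu>\<in>insert \<mu> S. if \<nu> = \<mu> then \<alpha> *\<^sub>R w else 0) = \<alpha> *\<^sub>R w"
        using S by (subst sum.delta) auto
      finally show ?thesis
        using sum by (simp add: algebra_simps)
    qed
    ultimately show ?thesis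
      using S by (intro exI[of _ "insert \<mu> S"] exI[of _ d]) auto
  qed
qed

section \<open>Euclidean Jordan algebras\<close>

context euclidean_jordan_algebra
begin

section \<open>Multiplication operators and their commutation\<close>

lemma linear_jp: "linear (jp x)"
  using jp_bilinear by (simp add: bilinear_def)

lemmas jp_simps = linear_add[OF linear_jp] linear_diff[OF linear_jp] linear_scale[OF linear_jp]
  linear_0[OF linear_jp]

lemma jp_add_left: "jp (x + y) z = jp x z + jp y z"
  using jp_bilinear by (rule bilinear_ladd)

lemma jp_scale_left: "jp (t *\<^sub>R x) z = t *\<^sub>R jp x z"
  using jp_bilinear by (rule bilinear_lmul)

lemma jp_self_adjoint: "jp x y \<bullet> z = y \<bullet> jp x z"
  using inner_jp_assoc[of y x z] jp_commute[of x y] by simp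

lemma jp_unit_right: "jp x e = x"
  using jp_unit jp_commute by metis

lemma jordan_identity_polarized:
  "jp z (jp (jp x y) u) + jp x (jp (jp y z) u) + jp y (jp (jp z x) u) =
   jp (jp x y) (jp z u) + jp (jp y z) (jp x u) + jp (jp z x) (jp y u)" (is "?l = ?r")
proof -
  define f where "f x = jp x (jp (jp x x) u) - jp (jp x x) (jp x u)" for x
  have f0: "f x = 0" for x
    using jordan_identity[of x u] by (simp add: f_def)
  have c: "jp y x = jp x y" "jp z x = jp x z" "jp z y = jp y z"
    by (simp_all add: jp_commute)
  \<comment> \<open>Inclusion-exclusion extracts the trilinear part of the cubic map
    \<open>f\<close>; each product occurs twice by commutativity, whence the factor 2.\<close>
  have "f (x + y + z) - f (x + y) - f (y + z) - f (x + z) + f x + f y + f z = 2 *\<^sub>R (?l - ?r)"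
    by (simp add: f_def jp_add_left jp_simps c scaleR_2)
  then show ?thesis
    by (simp add: f0)
qed

text \<open>In the polarized identity the right-hand side is symmetric in all four variables, so the
  left-hand side is invariant under exchanging \<open>z\<close> and \<open>u\<close>.\<close>

lemma jp_triple:
  "jp (jp (jp x y) z) u = jp z (jp (jp x y) u) + jp x (jp (jp y z) u) + jp y (jp (jp z x) u)
     - jp x (jp z (jp y u)) - jp y (jp z (jp x u))"
proof -
  have "jp z (jp (jp x y) u) + jp x (jp (jp y z) u) + jp y (jp (jp z x) u) =
    jp u (jp (jp x y) z) + jp x (jp (jp y u) z) + jp y (jp (jp u x) z)"
    using jordan_identity_polarized[of z x y u] jordan_identity_polarized[of u x y z]
    by (simp add: jp_commute algebra_simps)
  then show ?thesis
    by (simp add: jp_commute algebra_simps)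
qed

text \<open>By \<open>jp_triple\<close>, multiplication by the power n+2 of \<open>x\<close> is a
  polynomial in the multiplications by \<open>x\<close>, its square and the powers n and n+1. Hence
  the two-step induction, and hence commutation with the square is carried along.\<close>

lemma jp_powers_commute:
  "jp ((jp x ^^ n) e) (jp x u) = jp x (jp ((jp x ^^ n) e) u) \<and>
   jp ((jp x ^^ n) e) (jp (jp x x) u) = jp (jp x x) (jp ((jp x ^^ n) e) u)"
proof (induction n arbitrary: u rule: induct_nat_012)
  case 0
  then show ?case
    by (simp add: jp_unit)
next
  case 1
  then show ?case
    by (simp add: jp_unit_right jordan_identity[of x])
next
  case (ge2 n)
  define p where "p = (jp x ^^ n) e"
  define q where "q = jp x p"
  have p: "jp p (jp x u) = jp x (jp p u)" "jp p (jp (jp x x) u) = jp (jp x x) (jp p u)" for u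
    using ge2(1)[of u] by (simp_all only: p_def)
  have q: "jp q (jp x u) = jp x (jp q u)" "jp q (jp (jp x x) u) = jp (jp x x) (jp q u)" for u
    using ge2(2)[of u] by (simp_all only: p_def q_def funpow.simps o_apply)
  have next_eq: "jp (jp x q) u = 2 *\<^sub>R jp x (jp q u) + jp p (jp (jp x x) u)
      - jp x (jp x (jp p u)) - jp p (jp x (jp x u))" for u
    using jp_triple[of x p x u] jp_commute[of p x] jp_commute[of "jp x p" x]
    by (simp add: q_def scaleR_2)
  have "jp (jp x q) (jp x u) = jp x (jp (jp x q) u)"
    by (simp only: next_eq jp_simps p q jordan_identity[of x])
  moreover have "jp (jp x q) (jp (jp x x) u) = jp (jp x x) (jp (jp x q) u)"
    by (simp only: next_eq jp_simps p q jordan_identity[of x])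
  moreover have "(jp x ^^ Suc (Suc n)) e = jp x q"
    by (simp add: q_def p_def)
  ultimately show ?case
    by (simp only:)
qed

section \<open>Spectral decomposition\<close>

theorem spectral_decomposition:
  obtains S c where "finite S" "x = (\<Sum>\<mu>\<in>S. \<mu> *\<^sub>R c \<mu>)" "(\<Sum>\<mu>\<in>S. c \<mu>) = e"
    "\<And>\<mu>. \<mu> \<in> S \<Longrightarrow> jp (c \<mu>) (c \<mu>) = c \<mu>"
    "\<And>\<mu> \<nu>. \<mu> \<noteq> \<nu> \<Longrightarrow> jp (c \<mu>) (c \<nu>) = 0"
proof -
  define A where "A = span (range (\<lambda>n. (jp x ^^ n) e))"
  have comm: "jp v (jp x u) = jp x (jp v u)" if "v \<in> A" for v u
    using that unfolding A_def
  proof (induction rule: span_induct_alt)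
    case base
    show ?case
      using jp_scale_left[of 0 0] by (simp add: jp_simps)
  next
    case (step c v y)
    then show ?case
      using jp_powers_commute by (auto simp: jp_add_left jp_scale_left jp_simps)
  qed
  have inv: "jp x v \<in> A" if "v \<in> A" for v
    using that unfolding A_def
  proof (induction rule: span_induct_alt)
    case base
    show ?case
      by (simp add: jp_simps span_zero)
  next
    case (step c v y)
    then obtain n where "v = (jp x ^^ n) e"
      by blast
    then have "jp x v = (jp x ^^ Suc n) e"
      by simp
    then have "jp x v \<in> span (range (\<lambda>n. (jp x ^^ n) e))"
      by (metis rangeI span_base)
    then show ?case
      using step by (simp add: jp_simps span_add span_scale)
  qed
  have "e = (jp x ^^ 0) e"
    by simp
  then have eA: "e \<in> A"
    unfolding A_def by (metis rangeI span_base)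
  have "subspace A"
    by (simp add: A_def)
  from self_adjoint_eigen_decomposition[OF linear_jp jp_self_adjoint this inv eA]
  obtain S c where S: "finite S" and cA: "\<And>\<mu>. c \<mu> \<in> A"
    and eig: "\<And>\<mu>. jp x (c \<mu>) = \<mu> *\<^sub>R c \<mu>" and sum: "e = (\<Sum>\<mu>\<in>S. c \<mu>)"
    by auto
  \<comment> \<open>Multiplication by \<open>c \<mu>\<close> commutes with \<open>jp x\<close> and
    so preserves its eigenspaces. The product thus lies in the eigenspaces of both
    \<open>\<mu>\<close> and \<open>\<nu>\<close>.\<close>
  have orth: "jp (c \<mu>) (c \<nu>) = 0" if "\<mu> \<noteq> \<nu>" for \<mu> \<nu>
  proof -
    have "jp x (jp (c \<mu>) (c \<nu>)) = \<nu> *\<^sub>R jp (c \<mu>) (c \<nu>)"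
      using comm[OF cA[of \<mu>], of "c \<nu>"] by (simp add: eig jp_simps)
    moreover have "jp x (jp (c \<nu>) (c \<mu>)) = \<mu> *\<^sub>R jp (c \<nu>) (c \<mu>)"
      using comm[OF cA[of \<nu>], of "c \<mu>"] by (simp add: eig jp_simps)
    ultimately have "(\<mu> - \<nu>) *\<^sub>R jp (c \<mu>) (c \<nu>) = 0"
      using jp_commute[of "c \<mu>" "c \<nu>"] by (simp add: scaleR_diff_left)
    then show ?thesis
      using that by simp
  qed
  \<comment> \<open>Multiply the decomposition of the unit by \<open>c \<mu>\<close>: orthogonality
    leaves only the square.\<close>
  have idem: "jp (c \<mu>) (c \<mu>) = c \<mu>" if "\<mu> \<in> S" for \<mu>
  proof -
    have "c \<mu> = jp (c \<mu>) (\<Sum>\<nu>\<in>S. c \<nu>)"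
      using sum jp_unit_right by metis
    also have "\<dots> = (\<Sum>\<nu>\<in>S. jp (c \<mu>) (c \<nu>))"
      by (rule linear_sum[OF linear_jp])
    also have "\<dots> = (\<Sum>\<nu>\<in>S. if \<nu> = \<mu> then jp (c \<mu>) (c \<mu>) else 0)"
      by (intro sum.cong) (auto simp: orth)
    also have "\<dots> = jp (c \<mu>) (c \<mu>)"
      using S that by simp
    finally show ?thesis
      by simp
  qed
  have "x = jp x (\<Sum>\<mu>\<in>S. c \<mu>)"
    using sum jp_unit_right by metis
  also have "\<dots> = (\<Sum>\<mu>\<in>S. \<mu> *\<^sub>R c \<mu>)"
    by (simp add: linear_sum[OF linear_jp] eig)
  finally show ?thesis
    using that[of S c] S sum idem orth by metis
qed

section \<open>Self-duality of the cone of squares\<close>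

lemma jp_sum_orthogonal_idempotents:
  assumes S: "finite S" and idem: "\<And>i. i \<in> S \<Longrightarrow> jp (c i) (c i) = c i"
    and orth: "\<And>i j. i \<in> S \<Longrightarrow> j \<in> S \<Longrightarrow> i \<noteq> j \<Longrightarrow> jp (c i) (c j) = 0"
  shows "jp (\<Sum>i\<in>S. f i *\<^sub>R c i) (\<Sum>i\<in>S. f i *\<^sub>R c i) = (\<Sum>i\<in>S. (f i)\<^sup>2 *\<^sub>R c i)"
proof -
  have inner: "jp (c i) (\<Sum>j\<in>S. f j *\<^sub>R c j) = f i *\<^sub>R c i" if i: "i \<in> S" for i
  proof -
    have "jp (c i) (\<Sum>j\<in>S. f j *\<^sub>R c j) = (\<Sum>j\<in>S. if j = i then f i *\<^sub>R c i else 0)"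
      unfolding linear_sum[OF linear_jp] using i by (intro sum.cong) (auto simp: jp_simps idem orth)
    then show ?thesis
      using S i by simp
  qed
  have "jp (\<Sum>i\<in>S. f i *\<^sub>R c i) (\<Sum>i\<in>S. f i *\<^sub>R c i) =
      (\<Sum>i\<in>S. jp (f i *\<^sub>R c i) (\<Sum>i\<in>S. f i *\<^sub>R c i))"
    by (subst (1 2) jp_commute) (simp add: linear_sum[OF linear_jp, of _ "\<lambda>i. f i *\<^sub>R c i"])
  also have "\<dots> = (\<Sum>i\<in>S. (f i)\<^sup>2 *\<^sub>R c i)"
    by (intro sum.cong) (auto simp: jp_scale_left inner power2_eq_square)
  finally show ?thesis .
qed

text \<open>By the Peirce identity \<open>2T\<^sup>3 - 3T\<^sup>2 + T = 0\<close> for \<open>T = jp c\<close>, one has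
  \<open>T = T\<^sup>2 + 4(T - T\<^sup>2)\<^sup>2\<close>, a sum of squares of self-adjoint maps.\<close>

lemma idempotent_inner_square_nonneg:
  assumes c: "jp c c = c"
  shows "0 \<le> c \<bullet> jp y y"
proof -
  define T where "T = jp c"
  have peirce: "T (T (T u)) + T (T (T u)) = T (T u) + T (T u) + T (T u) - T u" for u
    using jp_triple[of c c c u] c by (simp add: T_def algebra_simps)
  have adj: "T u \<bullet> v = u \<bullet> T v" for u v
    by (simp add: T_def jp_self_adjoint)
  have lin: "linear T"
    by (simp add: T_def linear_jp)
  \<comment> \<open>Since \<open>T\<close> has eigenvalues among 0, 1/2 and 1, \<open>z\<close> is a
    quarter of the component of \<open>y\<close> in the 1/2-eigenspace; hence \<open>T\<close>
    halves it.\<close>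
  define z where "z = T y - T (T y)"
  have "T z + T z = T (T y) + T (T y) - (T (T (T y)) + T (T (T y)))"
    by (simp add: z_def linear_diff[OF lin] algebra_simps)
  also have "\<dots> = z"
    by (simp add: peirce z_def)
  finally have half: "v \<bullet> T z = (1/2) * (v \<bullet> z)" for v
    by (metis inner_add_right mult_2 nonzero_mult_div_cancel_left times_divide_eq_left mult_1 zero_neq_numeral)
  have 1: "T y \<bullet> z = (1/2) * (y \<bullet> z)"
    by (simp only: adj half)
  have 2: "T (T y) \<bullet> z = (1/2) * (T y \<bullet> z)"
    by (simp only: adj[of "T y"] half)
  have "z \<bullet> z = (1/4) * (y \<bullet> z)"
    using 1 2 by (subst z_def) (simp add: inner_diff_left)
  moreover have "y \<bullet> z = T y \<bullet> y - T y \<bullet> T y"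
    by (simp add: z_def inner_diff_right adj inner_commute)
  ultimately have "T y \<bullet> y = T y \<bullet> T y + 4 * (z \<bullet> z)"
    by simp
  moreover have "c \<bullet> jp y y = T y \<bullet> y"
    using inner_jp_assoc[of c y y] by (simp add: T_def)
  ultimately show ?thesis
    by simp
qed

text \<open>A square is a combination of idempotents with coefficients \<open>\<mu>\<^sup>2\<close>,
  and idempotents pair nonnegatively with squares.\<close>

lemma squares_inner_nonneg: "0 \<le> jp x x \<bullet> jp y y"
proof -
  obtain S c where S: "finite S" "x = (\<Sum>\<mu>\<in>S. \<mu> *\<^sub>R c \<mu>)"
    "\<And>\<mu>. \<mu> \<in> S \<Longrightarrow> jp (c \<mu>) (c \<mu>) = c \<mu>" "\<And>\<mu> \<nu>. \<mu> \<noteq> \<nu> \<Longrightarrow> jp (c \<mu>) (c \<nu>) = 0"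
    using spectral_decomposition[of x] by metis
  have "jp x x = (\<Sum>\<mu>\<in>S. \<mu>\<^sup>2 *\<^sub>R c \<mu>)"
    unfolding S(2) using S by (intro jp_sum_orthogonal_idempotents) auto
  moreover have "0 \<le> (\<Sum>\<mu>\<in>S. \<mu>\<^sup>2 * (c \<mu> \<bullet> jp y y))"
    using S(3) by (intro sum_nonneg mult_nonneg_nonneg idempotent_inner_square_nonneg) auto
  ultimately show ?thesis
    by (simp add: inner_sum_left)
qed

text \<open>Pairing \<open>b\<close> with its own spectral idempotents, which are squares, shows
  that its eigenvalues are nonnegative; the square root is then taken eigenvalue by
  eigenvalue.\<close>

lemma square_if_dual_nonneg:
  assumes b: "\<And>z. 0 \<le> jp z z \<bullet> b"
  shows "\<exists>y. b = jp y y"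
proof -
  obtain S c where S: "finite S" "b = (\<Sum>\<mu>\<in>S. \<mu> *\<^sub>R c \<mu>)"
    "\<And>\<mu>. \<mu> \<in> S \<Longrightarrow> jp (c \<mu>) (c \<mu>) = c \<mu>" "\<And>\<mu> \<nu>. \<mu> \<noteq> \<nu> \<Longrightarrow> jp (c \<mu>) (c \<nu>) = 0"
    using spectral_decomposition[of b] by metis
  \<comment> \<open>An index in \<open>S\<close> whose idempotent is zero can have either
    sign.\<close>
  have nonneg: "c \<mu> = 0 \<or> 0 \<le> \<mu>" if \<mu>: "\<mu> \<in> S" for \<mu>
  proof -
    have "c \<mu> \<bullet> c \<nu> = 0" if "\<nu> \<noteq> \<mu>" for \<nu>
      using inner_jp_assoc[of "c \<mu>" "c \<mu>" "c \<nu>"] S(3)[OF \<mu>] S(4)[of \<mu> \<nu>] that by simp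
    then have "c \<mu> \<bullet> b = (\<Sum>\<nu>\<in>S. if \<nu> = \<mu> then \<mu> * (c \<mu> \<bullet> c \<mu>) else 0)"
      unfolding S(2) inner_sum_right by (intro sum.cong) auto
    also have "\<dots> = \<mu> * (c \<mu> \<bullet> c \<mu>)"
      using S(1) \<mu> by simp
    finally have "0 \<le> \<mu> * (c \<mu> \<bullet> c \<mu>)"
      using b[of "c \<mu>"] S(3)[OF \<mu>] by simp
    then show ?thesis
      using inner_gt_zero_iff[of "c \<mu>"] zero_le_mult_iff[of \<mu> "c \<mu> \<bullet> c \<mu>"] by linarith
  qed
  \<comment> \<open>The absolute value alters only terms with zero idempotent.\<close>
  have "jp (\<Sum>\<mu>\<in>S. sqrt \<bar>\<mu>\<bar> *\<^sub>R c \<mu>) (\<Sum>\<mu>\<in>S. sqrt \<bar>\<mu>\<bar> *\<^sub>R c \<mu>) = (\<Sum>\<mu>\<in>S. (sqrt \<bar>\<mu>\<bar>)\<^sup>2 *\<^sub>R c \<mu>)"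
    using S by (intro jp_sum_orthogonal_idempotents) auto
  also have "\<dots> = b"
    unfolding S(2) using nonneg by (intro sum.cong) fastforce+
  finally show ?thesis
    by metis
qed

sublocale self_dual_cone "symmetric_cone jp"
proof
  show "y \<in> symmetric_cone jp \<longleftrightarrow> (\<forall>x\<in>symmetric_cone jp. 0 \<le> x \<bullet> y)" for y
    unfolding symmetric_cone_def using squares_inner_nonneg square_if_dual_nonneg[of y] by blast
qed

end

theorem theorem10p6:
  fixes jp :: "'a::euclidean_space \<Rightarrow> 'a \<Rightarrow> 'a"
    and e a b :: 'a
    and L :: "'a \<Rightarrow> 'a"
  assumes "euclidean_jordan_algebra jp e"
    and "L = rank_one a b"
  shows "((cone_pos jp a \<and> cone_pos jp b \<or> cone_neg jp a \<and> cone_neg jp b) \<longleftrightarrow>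
            (\<forall>x. x \<noteq> 0 \<and> cone_nonneg jp x \<longrightarrow> cone_pos jp (L x))) \<and>
         ((\<forall>x. x \<noteq> 0 \<and> cone_nonneg jp x \<longrightarrow> cone_pos jp (L x)) \<longleftrightarrow>
            L \<in> Q_transformations jp)"
proof -
  interpret euclidean_jordan_algebra jp e
    by (rule assms(1))
  have "linear L"
    unfolding assms(2) rank_one_def
    by (rule linearI) (simp_all add: inner_add_right scaleR_add_left)
  then show ?thesis
    using rank_one_positive_iff[of a b] rank_one_LCP_solvable_iff[of a b]
    unfolding cone_pos_def cone_neg_def cone_nonneg_def Q_transformations_def assms(2)
    by blast
qed

end
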